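(* Let $H_1,H_2$ be complex Hilbert spaces, let $T \in \overline{\mathcal{AN}(H_1,H_2)}$ and let $T = W|T|$ be the polar decomposition of $T$. Then $T = \alpha W + K$ for some compact operator $K \in \mathcal{K}(H_1,H_2)$ and some real number $\alpha \geq 0$.
   Context: Hilbert spaces are complex, of arbitrary dimension. $\mathcal{B}(H_1,H_2)$ is the space of bounded linear operators with the operator norm, and $\mathcal{K}(H_1,H_2)$ is the set of compact operators. $T\in\mathcal{B}(H_1,H_2)$ is norm attaining if there is $x\in H_1$ with $\|x\|=1$ and $\|Tx\|=\|T\|$. $T$ is absolutely norm attaining (an $\mathcal{AN}$-operator) if for every nonzero closed subspace $M$ of $H_1$ the restriction $T|_M:M\to H_2$ is norm attaining. $\mathcal{AN}(H_1,H_2)$ is the set of $\mathcal{AN}$-operators, and $\overline{\mathcal{A}}$ denotes the closure of $\mathcal{A}\subseteq\mathcal{B}(H_1,H_2)$ in the operator norm. $|T|=(T^*T)^{1/2}$. The polar decomposition of $T$ is $T=W|T|$, where $W\in\mathcal{B}(H_1,H_2)$ is the unique partial isometry with $T=W|T|$ and $N(W)=N(T)$ ($N(\cdot)$ denotes the null space). *)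

theory Defs
  imports "HOL-Analysis.Analysis"
begin

text \<open>
  Complex inner product spaces are built on top of the library class of real ones, so that norm,
  metric, topology and real bounded operators are inherited. The real inner product is the real part
  of the complex one, hence the inherited norm satisfies \<open>norm x ^ 2 = Re (cinner x x)\<close>, and
  positive definiteness of \<open>cinner\<close> comes from positive definiteness of \<open>inner\<close>. The complex
  inner product is linear in its first argument.
\<close>

class complex_inner = real_inner +
  fixes scaleC :: "complex \<Rightarrow> 'a \<Rightarrow> 'a" (infixr "*\<^sub>C" 75)
    and cinner :: "'a \<Rightarrow> 'a \<Rightarrow> complex"
  assumes scaleC_add_right: "c *\<^sub>C (x + y) = c *\<^sub>C x + c *\<^sub>C y"
    and scaleC_add_left: "(c + d) *\<^sub>C x = c *\<^sub>C x + d *\<^sub>C x"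
    and scaleC_scaleC: "c *\<^sub>C (d *\<^sub>C x) = (c * d) *\<^sub>C x"
    and scaleR_scaleC: "r *\<^sub>R x = complex_of_real r *\<^sub>C x"
    and cinner_commute: "cinner x y = cnj (cinner y x)"
    and cinner_add_left: "cinner (x + y) z = cinner x z + cinner y z"
    and cinner_scaleC_left: "cinner (c *\<^sub>C x) y = c * cinner x y"
    and inner_eq_Re_cinner: "inner x y = Re (cinner x y)"

class complex_hilbert_space = complex_inner + complete_space

instantiation complex :: complex_hilbert_space
begin

definition scaleC_complex :: "complex \<Rightarrow> complex \<Rightarrow> complex"
  where "scaleC_complex c x = c * x"

definition cinner_complex :: "complex \<Rightarrow> complex \<Rightarrow> complex"
  where "cinner_complex x y = x * cnj y"

instance
  by intro_classes
    (simp_all add: scaleC_complex_def cinner_complex_def inner_complex_def scaleR_conv_of_real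
      algebra_simps)

end

definition csubspace :: "'a::complex_inner set \<Rightarrow> bool"
  where "csubspace M \<longleftrightarrow>
    0 \<in> M \<and> (\<forall>x\<in>M. \<forall>y\<in>M. x + y \<in> M) \<and> (\<forall>c. \<forall>x\<in>M. c *\<^sub>C x \<in> M)"

text \<open>
  The library type of bounded operators consists of the real-linear ones. The space
  \<open>\<B>(H\<^sub>1,H\<^sub>2)\<close> is its subset of complex-linear operators. This subset is closed, so closures in
  operator norm may be taken in the ambient type.
\<close>

definition clinear_op :: "('a::complex_inner \<Rightarrow>\<^sub>L 'b::complex_inner) \<Rightarrow> bool"
  where "clinear_op T \<longleftrightarrow> (\<forall>c x. T (c *\<^sub>C x) = c *\<^sub>C T x)"

lemma norm_scaleC: "norm (c *\<^sub>C x) = cmod c * norm (x::'a::complex_inner)"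
proof -
  have r: "cinner y (d *\<^sub>C z) = cnj d * cinner y z" for d and y z :: 'a
    by (metis cinner_commute cinner_scaleC_left complex_cnj_mult)
  have "Im (cinner x x) = 0"
    using arg_cong[OF cinner_commute[of x x], of Im] by simp
  then have "cinner x x = complex_of_real (inner x x)"
    by (simp add: complex_eq_iff inner_eq_Re_cinner)
  then have "cinner (c *\<^sub>C x) (c *\<^sub>C x) = complex_of_real ((cmod c)\<^sup>2 * inner x x)"
    by (simp add: cinner_scaleC_left r complex_norm_square mult.assoc[symmetric] del: of_real_power)
  then have "inner (c *\<^sub>C x) (c *\<^sub>C x) = (cmod c)\<^sup>2 * inner x x"
    by (simp only: inner_eq_Re_cinner Re_complex_of_real)
  then show ?thesis
    by (simp add: norm_eq_sqrt_inner real_sqrt_mult)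
qed

lemma bounded_linear_scaleC: "bounded_linear (\<lambda>x::'a::complex_inner. c *\<^sub>C x)"
  by (rule bounded_linear_intro[where K = "cmod c"])
    (simp_all add: scaleC_add_right scaleR_scaleC scaleC_scaleC norm_scaleC mult.commute)

lemma closed_clinear_op: "closed {T :: 'a::complex_inner \<Rightarrow>\<^sub>L 'b::complex_inner. clinear_op T}"
proof -
  have "closed {T :: 'a \<Rightarrow>\<^sub>L 'b. T (c *\<^sub>C x) = c *\<^sub>C T x}" for c x
    by (intro closed_Collect_eq continuous_intros
        bounded_linear.continuous_on[OF bounded_linear_scaleC])
  then show ?thesis
    unfolding clinear_op_def by (intro closed_Collect_all)
qed

definition compact_op :: "('a::complex_inner \<Rightarrow>\<^sub>L 'b::complex_inner) \<Rightarrow> bool"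
  where "compact_op K \<longleftrightarrow> clinear_op K \<and> compact (closure (blinfun_apply K ` cball 0 1))"

text \<open>
  The operator norm of the restriction of \<open>T\<close> to a subspace, as in the library's \<open>onorm\<close>
  (the argument \<open>0\<close> contributes the value \<open>0\<close>).
\<close>

definition onorm_on :: "'a set \<Rightarrow> ('a::complex_inner \<Rightarrow>\<^sub>L 'b::complex_inner) \<Rightarrow> real"
  where "onorm_on M T = (SUP x\<in>M. norm (T x) / norm x)"

lemma onorm_on_UNIV: "onorm_on UNIV T = norm T"
  by (simp add: onorm_on_def norm_blinfun.rep_eq onorm_def)

definition norm_attaining_on :: "'a set \<Rightarrow> ('a::complex_inner \<Rightarrow>\<^sub>L 'b::complex_inner) \<Rightarrow> bool"
  where "norm_attaining_on M T \<longleftrightarrow> (\<exists>x\<in>M. norm x = 1 \<and> norm (T x) = onorm_on M T)"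

definition AN_ops :: "('a::complex_inner \<Rightarrow>\<^sub>L 'b::complex_inner) set"
  where "AN_ops = {T. clinear_op T \<and>
    (\<forall>M. csubspace M \<and> closed M \<and> M \<noteq> {0} \<longrightarrow> norm_attaining_on M T)}"

definition is_adjoint ::
  "('a::complex_inner \<Rightarrow>\<^sub>L 'b::complex_inner) \<Rightarrow> ('b \<Rightarrow>\<^sub>L 'a) \<Rightarrow> bool"
  where "is_adjoint T S \<longleftrightarrow> (\<forall>x y. cinner (T x) y = cinner x (S y))"

definition positive_op :: "('a::complex_inner \<Rightarrow>\<^sub>L 'a) \<Rightarrow> bool"
  where "positive_op A \<longleftrightarrow> clinear_op A \<and> (\<forall>x. cinner (A x) x \<in> \<real>\<^sub>\<ge>\<^sub>0)"

text \<open>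
  \<open>is_modulus T A\<close> says \<open>A = |T|\<close>: on Hilbert spaces \<open>T\<close> has exactly one adjoint \<open>S\<close>, and \<open>S T\<close>
  has exactly one positive square root.
\<close>

definition is_modulus ::
  "('a::complex_inner \<Rightarrow>\<^sub>L 'b::complex_inner) \<Rightarrow> ('a \<Rightarrow>\<^sub>L 'a) \<Rightarrow> bool"
  where "is_modulus T A \<longleftrightarrow> positive_op A \<and> (\<exists>S. is_adjoint T S \<and> A o\<^sub>L A = S o\<^sub>L T)"

definition null_space :: "('a::complex_inner \<Rightarrow>\<^sub>L 'b::complex_inner) \<Rightarrow> 'a set"
  where "null_space T = {x. T x = 0}"

definition partial_isometry :: "('a::complex_inner \<Rightarrow>\<^sub>L 'b::complex_inner) \<Rightarrow> bool"
  where "partial_isometry W \<longleftrightarrow> clinear_op W \<and>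
    (\<forall>x. (\<forall>y\<in>null_space W. cinner x y = 0) \<longrightarrow> norm (W x) = norm x)"

definition polar_decomposition ::
  "('a::complex_inner \<Rightarrow>\<^sub>L 'b::complex_inner) \<Rightarrow> ('a \<Rightarrow>\<^sub>L 'b) \<Rightarrow> ('a \<Rightarrow>\<^sub>L 'a) \<Rightarrow> bool"
  where "polar_decomposition T W A \<longleftrightarrow>
    is_modulus T A \<and> partial_isometry W \<and> T = W o\<^sub>L A \<and> null_space W = null_space T"

end

theory Submission
  imports Defs
begin

text \<open>
  Consider the values of \<open>\<parallel>T x\<parallel>\<^sup>2\<close> at unit vectors \<open>x\<close> of subspaces of finite codimension. If
  both values \<open>\<le> a\<close> and values \<open>\<ge> b > a\<close> occur on every such subspace, one finds an orthonormal sequence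
  \<open>g\<^sub>n\<close> with orthogonal images and \<open>\<parallel>T g\<^sub>n\<parallel>\<^sup>2\<close> strictly below and tending to \<open>b\<close>; on the closed span
  of the \<open>g\<^sub>n\<close> the norm of \<open>T\<close> is then not attained. This gap condition is stable under small
  perturbations, so it also fails on the closure of the \<open>\<A>\<N>\<close>-operators. Hence \<open>T\<^sup>*T\<close> is, up to
  \<open>\<epsilon>\<close>, a constant \<open>\<beta> = \<alpha>\<^sup>2\<close> on a subspace of finite codimension. Factoring
  \<open>T\<^sup>*T - \<alpha>\<^sup>2 = (|T| + \<alpha>) (|T| - \<alpha>)\<close> shows that \<open>|T| - \<alpha>\<close>, and with it \<open>T - \<alpha> W = W (|T| - \<alpha>)\<close>, is
  compact (for \<open>\<alpha> = 0\<close> the operator \<open>T\<close> itself is).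
\<close>

section \<open>Subspaces of finite codimension as common kernels of functionals\<close>

text \<open>For finite \<open>F\<close> these are the closed real subspaces of finite codimension.
  Intersecting two of them, or imposing one more orthogonality condition, only enlarges
  \<open>F\<close>.\<close>

definition common_kernel :: "('a::real_normed_vector \<Rightarrow>\<^sub>L real) set \<Rightarrow> 'a set"
  where "common_kernel F = {x. \<forall>f\<in>F. blinfun_apply f x = 0}"

lemma common_kernel_Un: "common_kernel (F \<union> G) = common_kernel F \<inter> common_kernel G"
  by (auto simp: common_kernel_def)

lemma common_kernel_insert:
  "x \<in> common_kernel (insert f F) \<longleftrightarrow> blinfun_apply f x = 0 \<and> x \<in> common_kernel F"
  by (auto simp: common_kernel_def)

lemma subspace_common_kernel: "subspace (common_kernel F)"
  by (auto simp: common_kernel_def subspace_def blinfun.bilinear_simps)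

text \<open>Induction on \<open>F\<close>: if the new functional does not already vanish on the
  common kernel, \<open>R\<close> is corrected along a kernel vector \<open>u\<close> with
  \<open>f u = 1\<close>. Finite rank is recorded only as relative compactness of the image of the
  unit ball, so no dimensions are counted.\<close>

lemma common_kernel_finite_complement:
  assumes "finite F"
  shows "\<exists>R. linear R \<and> compact (closure (R ` cball 0 1)) \<and> (\<forall>x. x - R x \<in> common_kernel F)"
  using assms
proof (induction F)
  case empty
  show ?case
  proof (intro exI conjI allI)
    show "linear (\<lambda>x::'a. 0::'a)" by (simp add: linear_zero)
    have "(\<lambda>x::'a. 0::'a) ` cball 0 1 = {0}" by (simp add: image_constant_conv)
    then show "compact (closure ((\<lambda>x::'a. 0::'a) ` cball 0 1))" by simp
    show "x - 0 \<in> common_kernel {}" for x :: 'a by (simp add: common_kernel_def)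
  qed
next
  case (insert f F)
  then obtain R where R: "linear R" "compact (closure (R ` cball 0 1))"
    "\<And>x. x - R x \<in> common_kernel F" by blast
  show ?case
  proof (cases "\<forall>u\<in>common_kernel F. blinfun_apply f u = 0")
    case True
    with R show ?thesis by (auto simp: common_kernel_insert)
  next
    case False
    then obtain v where v: "v \<in> common_kernel F" "blinfun_apply f v \<noteq> 0" by blast
    define u where "u = v /\<^sub>R blinfun_apply f v"
    have u: "u \<in> common_kernel F" "blinfun_apply f u = 1"
      using v subspace_scale[OF subspace_common_kernel]
      by (auto simp: u_def blinfun.bilinear_simps)
    let ?h = "\<lambda>x. blinfun_apply f (x - R x)"
    let ?R = "\<lambda>x. R x + ?h x *\<^sub>R u"
    have lin: "linear ?R"
      by (rule linearI)
        (simp_all add: linear_add[OF R(1)] linear_scale[OF R(1)] blinfun.bilinear_simps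
          algebra_simps)
    let ?C = "closure (R ` cball 0 1)"
    \<comment> \<open>\<open>R\<close> is only given as linear, so the coefficient
      \<open>f x - f (R x)\<close> is read as a continuous function of the pair
      \<open>(f x, R x)\<close>, which stays in a compact product.\<close>
    let ?D = "(\<lambda>r. r *\<^sub>R u) ` ((\<lambda>(s, y). s - blinfun_apply f y) ` ({-norm f..norm f} \<times> ?C))"
    have "compact ?D"
      by (intro compact_continuous_image compact_Times R compact_Icc)
        (auto simp: case_prod_unfold intro!: continuous_intros)
    then have cD: "compact {x + y | x y. x \<in> ?C \<and> y \<in> ?D}"
      using R(2) compact_sums by blast
    have "?R ` cball 0 1 \<subseteq> {x + y | x y. x \<in> ?C \<and> y \<in> ?D}"
    proof safe
      fix x :: 'a assume x: "x \<in> cball 0 1"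
      have "\<bar>blinfun_apply f x\<bar> \<le> norm f * norm x"
        using norm_blinfun[of f x] by simp
      also have "\<dots> \<le> norm f" using x by (simp add: mult_left_le)
      finally have "blinfun_apply f x \<in> {-norm f..norm f}" by auto
      moreover have Rx: "R x \<in> ?C" using x by (intro subsetD[OF closure_subset] imageI)
      ultimately have "blinfun_apply f x - blinfun_apply f (R x)
          \<in> (\<lambda>(s, y). s - blinfun_apply f y) ` ({-norm f..norm f} \<times> ?C)"
        by (intro image_eqI[of _ _ "(blinfun_apply f x, R x)"]) auto
      then have "?h x *\<^sub>R u \<in> ?D" unfolding blinfun.diff_right by (rule imageI)
      with Rx show "\<exists>x' y. ?R x = x' + y \<and> x' \<in> ?C \<and> y \<in> ?D" by blast
    qed
    then have "closure (?R ` cball 0 1) \<subseteq> {x + y | x y. x \<in> ?C \<and> y \<in> ?D}"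
      by (intro closure_minimal compact_imp_closed cD)
    then have "compact (closure (?R ` cball 0 1))"
      using compact_Int_closed[OF cD closed_closure, of "?R ` cball 0 1"] by (simp add: Int_absorb1)
    moreover have "x - ?R x \<in> common_kernel (insert f F)" for x
    proof -
      have "x - ?R x = (x - R x) - ?h x *\<^sub>R u" by simp
      moreover have "\<dots> \<in> common_kernel F"
        by (intro subspace_diff subspace_scale subspace_common_kernel R u)
      moreover have "blinfun_apply f ((x - R x) - ?h x *\<^sub>R u) = 0"
        using u by (simp add: blinfun.bilinear_simps)
      ultimately show ?thesis unfolding common_kernel_insert by (simp only:)
    qed
    ultimately show ?thesis using lin by blast
  qed
qed

section \<open>Total boundedness and a compactness criterion\<close>

lemma totally_bounded_imp_compact_closure:
  fixes s :: "'a::complete_space set"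
  assumes "\<And>e. e > 0 \<Longrightarrow> \<exists>k. finite k \<and> s \<subseteq> (\<Union>x\<in>k. ball x e)"
  shows "compact (closure s)"
  unfolding compact_eq_totally_bounded
proof (intro conjI allI impI)
  show "complete (closure s)" by (simp add: complete_eq_closed)
  fix e :: real assume "e > 0"
  then obtain k where k: "finite k" "s \<subseteq> (\<Union>x\<in>k. ball x (e/2))"
    using assms[of "e/2"] by auto
  have "closure s \<subseteq> (\<Union>x\<in>k. cball x (e/2))"
    using k by (intro closure_minimal closed_UN) (auto simp: less_imp_le dest!: subsetD)
  also have "\<dots> \<subseteq> (\<Union>x\<in>k. ball x e)" using \<open>e > 0\<close> by auto
  finally show "\<exists>k. finite k \<and> closure s \<subseteq> (\<Union>x\<in>k. ball x e)" using k(1) by blast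
qed

text \<open>
  The projection \<open>R\<close> along the common kernel may have norm unbounded in \<open>e\<close>, so \<open>K\<close> is not
  approximated by \<open>K \<circ> R\<close>; instead, \<open>K\<close> is estimated on differences of vectors with nearby images
  under \<open>R\<close>.
\<close>

lemma compact_if_small_on_common_kernels:
  fixes K :: "'a::real_normed_vector \<Rightarrow>\<^sub>L 'b::{real_normed_vector, complete_space}"
  assumes "\<And>e. e > 0 \<Longrightarrow> \<exists>F. finite F \<and> (\<forall>x\<in>common_kernel F. norm (K x) \<le> e * norm x)"
  shows "compact (closure (blinfun_apply K ` cball 0 1))"
proof (rule totally_bounded_imp_compact_closure)
  fix e :: real assume e: "e > 0"
  obtain F where F: "finite F" "\<And>x. x \<in> common_kernel F \<Longrightarrow> norm (K x) \<le> e/8 * norm x"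
    using assms[of "e/8"] e by auto
  obtain R where R: "linear R" "compact (closure (R ` cball 0 1))"
    "\<And>x. x - R x \<in> common_kernel F"
    using common_kernel_finite_complement[OF F(1)] by blast
  \<comment> \<open>\<open>d \<le> 1\<close> gives
    \<open>norm (?z - R ?z) \<le> 2 + 2 * d \<le> 4\<close>; the other bound gives
    \<open>norm K * (2 * d) \<le> e / 4\<close>. With the factor \<open>e / 8\<close> on the common
    kernel the total is \<open>3 * e / 4 < e\<close>.\<close>
  define d where "d = min 1 (e / (8 * (norm K + 1)))"
  have d: "d > 0" "d \<le> 1" using e by (auto simp: d_def add_nonneg_pos)
  have "norm K * d \<le> (norm K + 1) * (e / (8 * (norm K + 1)))"
    using e by (intro mult_mono) (auto simp: d_def)
  also have "\<dots> = e / 8"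
  proof -
    have "m * (e / (8 * m)) = e / 8" if "m \<noteq> 0" for m :: real
      using that by simp
    moreover have "norm K + 1 \<noteq> 0" using norm_ge_zero[of K] by linarith
    ultimately show ?thesis by blast
  qed
  finally have Kd: "norm K * d \<le> e / 8" .
  obtain k where k: "finite k" "closure (R ` cball 0 1) \<subseteq> (\<Union>p\<in>k. ball p d)"
    using R(2) d(1) unfolding compact_eq_totally_bounded by blast
  \<comment> \<open>The value is arbitrary if no such point exists; below, \<open>p\<close> is
    always taken near some \<open>R x\<close> with \<open>x\<close> in the unit ball, so one
    does.\<close>
  define w where "w p = (SOME x. x \<in> cball 0 1 \<and> R x \<in> ball p d)" for p
  show "\<exists>k. finite k \<and> blinfun_apply K ` cball 0 1 \<subseteq> (\<Union>x\<in>k. ball x e)"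
  proof (intro exI conjI)
    show "finite ((\<lambda>p. K (w p)) ` k)" using k(1) by simp
    show "blinfun_apply K ` cball 0 1 \<subseteq> (\<Union>x\<in>(\<lambda>p. K (w p)) ` k. ball x e)"
    proof
      fix y assume "y \<in> blinfun_apply K ` cball 0 1"
      then obtain x where x: "y = K x" "x \<in> cball 0 1" by blast
      have "R x \<in> closure (R ` cball 0 1)" using x(2) by (intro subsetD[OF closure_subset] imageI)
      then obtain p where p: "p \<in> k" "R x \<in> ball p d" using k(2) by blast
      have wp: "w p \<in> cball 0 1 \<and> R (w p) \<in> ball p d"
        unfolding w_def by (rule someI[of _ x]) (use x p in auto)
      let ?z = "w p - x"
      have Rz: "norm (R ?z) \<le> 2 * d"
        using wp p dist_triangle_less_add[of "R (w p)" p d "R x" d]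
        by (simp add: linear_diff[OF R(1)] dist_norm[symmetric] dist_commute)
      have z2: "norm ?z \<le> 2"
        using wp x norm_triangle_ineq4[of "w p" x] by simp
      have "norm (?z - R ?z) \<le> 4"
        using norm_triangle_ineq4[of ?z "R ?z"] Rz z2 d by linarith
      then have "norm (K (?z - R ?z)) \<le> e / 8 * 4"
        using F(2)[OF R(3), of ?z] e
        by (meson mult_left_mono order_trans less_imp_le zero_less_divide_iff zero_less_numeral)
      moreover have "norm (K (R ?z)) \<le> e / 4"
      proof -
        have "norm (K (R ?z)) \<le> norm K * norm (R ?z)" by (rule norm_blinfun)
        also have "\<dots> \<le> norm K * (2 * d)" using Rz by (intro mult_left_mono) auto
        finally show ?thesis using Kd by simp
      qed
      moreover have "K ?z = K (?z - R ?z) + K (R ?z)"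
        by (simp add: blinfun.bilinear_simps)
      ultimately have "norm (K ?z) \<le> e / 8 * 4 + e / 4"
        by (metis norm_triangle_mono)
      then have "norm (K ?z) < e" using e by simp
      then have "y \<in> ball (K (w p)) e"
        using x by (simp add: dist_norm blinfun.bilinear_simps)
      then show "y \<in> (\<Union>x\<in>(\<lambda>p. K (w p)) ` k. ball x e)" using p by blast
    qed
  qed
qed

section \<open>Orthogonal families with orthogonal images\<close>

text \<open>
  The left-hand side is there for strictness: a vector of the closed span at which the right-hand
  side is not positive is orthogonal to all \<open>w\<close> with \<open>\<parallel>T w\<parallel>\<^sup>2 < c\<close>.
\<close>

lemma orthogonal_family_form_lower_bound:
  fixes T :: "'a::real_inner \<Rightarrow>\<^sub>L 'b::real_inner"
  assumes unit: "\<And>v. v \<in> H \<Longrightarrow> norm v = 1"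
    and orth: "\<And>v w. v \<in> H \<Longrightarrow> w \<in> H \<Longrightarrow> v \<noteq> w \<Longrightarrow> inner v w = 0 \<and> inner (T v) (T w) = 0"
    and le: "\<And>v. v \<in> H \<Longrightarrow> (norm (T v))\<^sup>2 \<le> c"
    and x: "x \<in> closure (span H)" and w: "w \<in> H"
  shows "(c - (norm (T w))\<^sup>2) * (inner x w)\<^sup>2 \<le> c * (norm x)\<^sup>2 - (norm (T x))\<^sup>2"
proof -
  let ?P = "{x. (c - (norm (T w))\<^sup>2) * (inner x w)\<^sup>2 \<le> c * (norm x)\<^sup>2 - (norm (T x))\<^sup>2}"
  have "closed ?P"
    by (intro closed_Collect_le continuous_intros)
  moreover have "span H \<subseteq> ?P"
  proof
    fix x assume "x \<in> span H"
    then obtain t r where t: "finite t" "t \<subseteq> H" and xs: "x = (\<Sum>v\<in>t. r v *\<^sub>R v)"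
      unfolding span_explicit by blast
    have Tx: "T x = (\<Sum>v\<in>t. r v *\<^sub>R T v)"
      by (simp add: xs blinfun.sum_right blinfun.scaleR_right)
    have nx: "(norm x)\<^sup>2 = (\<Sum>v\<in>t. (r v)\<^sup>2)"
    proof -
      have "(norm x)\<^sup>2 = (\<Sum>v\<in>t. (norm (r v *\<^sub>R v))\<^sup>2)"
        unfolding xs using t orth
        by (intro norm_sum_Pythagorean)
          (auto simp: pairwise_def orthogonal_def subset_iff)
      also have "\<dots> = (\<Sum>v\<in>t. (r v)\<^sup>2)"
        using t unit by (intro sum.cong) auto
      finally show ?thesis .
    qed
    have nTx: "(norm (T x))\<^sup>2 = (\<Sum>v\<in>t. (r v)\<^sup>2 * (norm (T v))\<^sup>2)"
    proof -
      have "(norm (T x))\<^sup>2 = (\<Sum>v\<in>t. (norm (r v *\<^sub>R T v))\<^sup>2)"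
        unfolding Tx using t orth
        by (intro norm_sum_Pythagorean)
          (auto simp: pairwise_def orthogonal_def subset_iff)
      then show ?thesis by (simp add: power_mult_distrib)
    qed
    \<comment> \<open>Both forms are diagonal in the family, so their difference is a sum of
      nonnegative terms; the one at \<open>w\<close>, if present, is the left-hand side of the
      claim.\<close>
    have D: "c * (norm x)\<^sup>2 - (norm (T x))\<^sup>2 = (\<Sum>v\<in>t. (c - (norm (T v))\<^sup>2) * (r v)\<^sup>2)"
      unfolding nx nTx by (simp add: sum_distrib_left sum_subtractf algebra_simps)
    have nonneg: "(c - (norm (T v))\<^sup>2) * (r v)\<^sup>2 \<ge> 0" if "v \<in> t" for v
      using le[of v] t that by auto
    have xw: "inner x w = (\<Sum>v\<in>t. r v * inner v w)"
      by (simp add: xs inner_sum_left)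
    show "x \<in> ?P"
    proof (cases "w \<in> t")
      case True
      have "inner x w = (\<Sum>v\<in>t. if v = w then r w else 0)"
        unfolding xw using t w orth unit
        by (intro sum.cong) (auto simp: subset_iff dot_square_norm)
      also have "\<dots> = r w" using True t by simp
      finally show ?thesis
        using D member_le_sum[OF True, of "\<lambda>v. (c - (norm (T v))\<^sup>2) * (r v)\<^sup>2"] nonneg t by auto
    next
      case False
      have "inner x w = 0"
        unfolding xw using False t w orth by (intro sum.neutral) auto
      moreover have "0 \<le> c * (norm x)\<^sup>2 - (norm (T x))\<^sup>2"
        unfolding D using nonneg by (intro sum_nonneg) auto
      ultimately show ?thesis by simp
    qed
  qed
  ultimately have "closure (span H) \<subseteq> ?P" by (rule closure_minimal[rotated])
  then show ?thesis using x by blast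
qed

section \<open>Complex scalars in terms of the real inner product\<close>

lemma cinner_scaleC_right: "cinner x (c *\<^sub>C y) = cnj c * cinner x (y::'a::complex_inner)"
  by (metis cinner_commute cinner_scaleC_left complex_cnj_mult)

lemma inner_scaleC_ii_left: "inner (\<i> *\<^sub>C x) y = - inner x (\<i> *\<^sub>C (y::'a::complex_inner))"
  by (simp add: inner_eq_Re_cinner cinner_scaleC_left cinner_scaleC_right)

lemma inner_scaleC_ii_self: "inner x (\<i> *\<^sub>C x) = 0" for x :: "'a::complex_inner"
  using inner_scaleC_ii_left[of x x] by (simp add: inner_commute)

lemma scaleC_conv_scaleR: "c *\<^sub>C x = Re c *\<^sub>R x + Im c *\<^sub>R (\<i> *\<^sub>C (x::'a::complex_inner))"
proof -
  have "c *\<^sub>C x = (complex_of_real (Re c) + complex_of_real (Im c) * \<i>) *\<^sub>C x"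
    using complex_eq[of c] by (simp only: mult.commute)
  then show ?thesis by (simp only: scaleC_add_left scaleR_scaleC scaleC_scaleC)
qed

lemma scaleC_ii_ii: "\<i> *\<^sub>C (\<i> *\<^sub>C x) = - (x::'a::complex_inner)"
  using scaleR_scaleC[of "-1" x] by (simp add: scaleC_scaleC)

lemma subspace_closure:
  fixes S :: "'a::real_normed_vector set"
  assumes S: "subspace S"
  shows "subspace (closure S)"
  unfolding subspace_def
proof (intro conjI ballI allI)
  show "0 \<in> closure S" by (rule subsetD[OF closure_subset subspace_0[OF S]])
next
  fix x y assume "x \<in> closure S" "y \<in> closure S"
  then obtain f g where "\<And>n. f n \<in> S" "f \<longlonglongrightarrow> x" "\<And>n. g n \<in> S" "g \<longlonglongrightarrow> y"
    unfolding closure_sequential by blast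
  then show "x + y \<in> closure S"
    unfolding closure_sequential
    by (intro exI[of _ "\<lambda>n. f n + g n"]) (auto intro: tendsto_add subspace_add[OF S])
next
  fix c :: real and x assume "x \<in> closure S"
  then obtain f where "\<And>n. f n \<in> S" "f \<longlonglongrightarrow> x"
    unfolding closure_sequential by blast
  then show "c *\<^sub>R x \<in> closure S"
    unfolding closure_sequential
    by (intro exI[of _ "\<lambda>n. c *\<^sub>R f n"]) (auto intro: tendsto_intros subspace_scale[OF S])
qed

text \<open>Multiplication by \<open>\<i>\<close> permutes the generators up to sign, hence
  preserves their real span and, by continuity, its closure. Closure under real combinations then
  yields all complex scalars.\<close>

lemma csubspace_closure_span:
  fixes G :: "'a::complex_inner set"
  shows "csubspace (closure (span (G \<union> (*\<^sub>C) \<i> ` G)))"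
proof -
  let ?H = "G \<union> (*\<^sub>C) \<i> ` G" and ?j = "\<lambda>x::'a. \<i> *\<^sub>C x"
  have lin: "bounded_linear ?j" by (rule bounded_linear_scaleC)
  have sub: "subspace (closure (span ?H))" by (intro subspace_closure subspace_span)
  have "?j ` ?H \<subseteq> span ?H"
    by (auto simp: scaleC_ii_ii intro!: span_neg intro: span_base)
  then have "?j ` span ?H \<subseteq> span ?H"
    unfolding linear_span_image[OF bounded_linear.linear[OF lin], symmetric]
    by (rule span_minimal[OF _ subspace_span])
  then have "?j ` closure (span ?H) \<subseteq> closure (span ?H)"
    by (rule order_trans[OF closure_bounded_linear_image_subset[OF lin] closure_mono])
  then have "c *\<^sub>C x \<in> closure (span ?H)" if "x \<in> closure (span ?H)" for c x
    unfolding scaleC_conv_scaleR[of c]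
    using that by (intro subspace_add[OF sub] subspace_scale[OF sub]) blast+
  then show ?thesis
    unfolding csubspace_def by (intro conjI ballI allI subspace_0[OF sub] subspace_add[OF sub])
qed

lemma clinear_op_scaleC: "clinear_op T \<Longrightarrow> T (c *\<^sub>C x) = c *\<^sub>C T x"
  by (simp add: clinear_op_def)

section \<open>Excluding gaps in the values on unit vectors\<close>

text \<open>Intermediate value theorem on the quarter circle from a low vector \<open>x\<close> to a
  high vector \<open>y\<close>. Since \<open>hi\<close> covers every finite \<open>F\<close>,
  \<open>y\<close> can be taken orthogonal to \<open>x\<close>, which keeps the arc on the unit
  sphere.\<close>

lemma exists_unit_in_common_kernel_level:
  fixes T :: "'a::real_inner \<Rightarrow>\<^sub>L 'b::real_inner"
  assumes lo: "\<And>F. finite F \<Longrightarrow> \<exists>x\<in>common_kernel F. norm x = 1 \<and> (norm (T x))\<^sup>2 \<le> c"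
    and hi: "\<And>F. finite F \<Longrightarrow> \<exists>x\<in>common_kernel F. norm x = 1 \<and> c \<le> (norm (T x))\<^sup>2"
    and F: "finite F"
  shows "\<exists>x\<in>common_kernel F. norm x = 1 \<and> (norm (T x))\<^sup>2 = c"
proof -
  obtain x where x: "x \<in> common_kernel F" "norm x = 1" "(norm (T x))\<^sup>2 \<le> c"
    using lo[OF F] by blast
  obtain y where y: "y \<in> common_kernel (insert (blinfun_inner_right x) F)" "norm y = 1"
    "c \<le> (norm (T y))\<^sup>2"
    using hi[of "insert (blinfun_inner_right x) F"] F by blast
  then have xy: "inner x y = 0" "y \<in> common_kernel F"
    by (auto simp: common_kernel_insert)
  define z where "z t = cos t *\<^sub>R x + sin t *\<^sub>R y" for t :: real
  have "\<exists>t\<ge>0. t \<le> pi/2 \<and> (norm (T (z t)))\<^sup>2 = c"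
  proof (rule IVT')
    show "(norm (T (z 0)))\<^sup>2 \<le> c" using x by (simp add: z_def)
    show "c \<le> (norm (T (z (pi/2))))\<^sup>2" using y by (simp add: z_def)
    show "continuous_on {0..pi/2} (\<lambda>t. (norm (T (z t)))\<^sup>2)"
      unfolding z_def by (intro continuous_intros)
  qed simp
  then obtain t where t: "(norm (T (z t)))\<^sup>2 = c" by blast
  have "(norm (z t))\<^sup>2 = (cos t)\<^sup>2 + (sin t)\<^sup>2"
    using x(2) y(2) xy(1)
    unfolding norm_eq_1 power2_norm_eq_inner
    by (simp add: z_def inner_add_left inner_add_right inner_commute[of y x] power2_eq_square)
  then have "norm (z t) = 1"
    using norm_ge_zero[of "z t"] by (auto simp: power2_eq_1_iff)
  moreover have "z t \<in> common_kernel F"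
    unfolding z_def using x xy
    by (intro subspace_add subspace_scale subspace_common_kernel)
  ultimately show ?thesis using t by blast
qed

text \<open>A maximizing unit vector in the closed complex span \<open>M\<close> of the
  \<open>g n\<close> would reach the limit \<open>b\<close> of the levels \<open>c n\<close>. The
  form bound then makes it orthogonal to all generators of \<open>M\<close>, hence to
  itself.\<close>

lemma AN_ops_no_gap:
  fixes T :: "'a::complex_inner \<Rightarrow>\<^sub>L 'b::complex_inner"
  assumes T: "T \<in> AN_ops" and ab: "a < b"
    and lo: "\<And>F. finite F \<Longrightarrow> \<exists>x\<in>common_kernel F. norm x = 1 \<and> (norm (T x))\<^sup>2 \<le> a"
    and hi: "\<And>F. finite F \<Longrightarrow> \<exists>x\<in>common_kernel F. norm x = 1 \<and> b \<le> (norm (T x))\<^sup>2"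
  shows False
proof -
  have clin: "clinear_op T" using T by (simp add: AN_ops_def)
  \<comment> \<open>The levels start at \<open>c 0 = a\<close> and increase to \<open>b\<close>
    without reaching it; lying between \<open>a\<close> and \<open>b\<close>, each is attained on
    every common kernel.\<close>
  define c where "c n = b - (b - a) / (real n + 1)" for n
  have c: "a \<le> c n" "c n < b" for n
    using ab by (auto simp: c_def field_simps mult_right_mono)
  have c_lim: "c \<longlonglongrightarrow> b"
    using tendsto_diff[OF tendsto_const tendsto_mult[OF tendsto_const LIMSEQ_inverse_real_of_nat],
        of b "b - a"]
    by (simp add: c_def [abs_def] divide_inverse add.commute)
  \<comment> \<open>The conditions with \<open>\<i>\<close> turn real orthogonality into complex
    orthogonality, so that the \<open>g n\<close> together with their multiples by
    \<open>\<i>\<close> form a real orthonormal family with orthogonal images.\<close>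
  define P where "P g n z \<longleftrightarrow> norm z = 1 \<and> (norm (T z))\<^sup>2 = c n \<and>
    (\<forall>i<n. inner (g i) z = 0 \<and> inner (\<i> *\<^sub>C g i) z = 0 \<and>
      inner (T (g i)) (T z) = 0 \<and> inner (\<i> *\<^sub>C T (g i)) (T z) = 0)" for g and n :: nat and z
  have "\<exists>g. \<forall>n. P g n (g n)"
  proof (rule dependent_wellorder_choice)
    show "P f n z = P g n z" if "\<And>m. m < n \<Longrightarrow> f m = g m" for z f g n
      using that by (auto simp: P_def)
    show "\<exists>z. P g n z" for g n
    proof -
      define F where "F = (\<Union>i<n. {blinfun_inner_right (g i), blinfun_inner_right (\<i> *\<^sub>C g i),
        blinfun_inner_right (T (g i)) o\<^sub>L T, blinfun_inner_right (\<i> *\<^sub>C T (g i)) o\<^sub>L T})"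
      have "\<exists>z\<in>common_kernel F. norm z = 1 \<and> (norm (T z))\<^sup>2 = c n"
      proof (rule exists_unit_in_common_kernel_level)
        show "finite F" by (simp add: F_def)
      qed (meson lo hi c less_imp_le order_trans)+
      then show ?thesis
        by (auto simp: P_def F_def common_kernel_def)
    qed
  qed
  then obtain g where g: "\<And>n. P g n (g n)" by blast
  have unit: "norm (g n) = 1" and Tg: "(norm (T (g n)))\<^sup>2 = c n" for n
    using g[of n] by (auto simp: P_def)
  have orth: "inner (g i) (g j) = 0 \<and> inner (g i) (\<i> *\<^sub>C g j) = 0 \<and>
      inner (T (g i)) (T (g j)) = 0 \<and> inner (T (g i)) (\<i> *\<^sub>C T (g j)) = 0"
    if "i \<noteq> j" for i j
  proof (cases "i < j")
    case True
    then show ?thesis using g[of j] by (auto simp: P_def inner_scaleC_ii_left)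
  next
    case False
    then have "j < i" using that by simp
    then have "inner (g j) (g i) = 0 \<and> inner (\<i> *\<^sub>C g j) (g i) = 0 \<and>
        inner (T (g j)) (T (g i)) = 0 \<and> inner (\<i> *\<^sub>C T (g j)) (T (g i)) = 0"
      using g[of i] unfolding P_def by blast
    then show ?thesis by (simp only: inner_commute[of "g i"] inner_commute[of "T (g i)"])
  qed
  define H where "H = range g \<union> (*\<^sub>C) \<i> ` range g"
  define M where "M = closure (span H)"
  have H_cases: "\<exists>n. v = g n \<or> v = \<i> *\<^sub>C g n" if "v \<in> H" for v
    using that by (auto simp: H_def)
  have H_unit: "norm v = 1" if "v \<in> H" for v
    using H_cases[OF that] unit by (auto simp: norm_scaleC)
  have H_orth: "inner v w = 0 \<and> inner (T v) (T w) = 0"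
    if vw: "v \<in> H" "w \<in> H" "v \<noteq> w" for v w
  proof -
    obtain i where "v = g i \<or> v = \<i> *\<^sub>C g i" using H_cases[OF vw(1)] by blast
    moreover obtain j where "w = g j \<or> w = \<i> *\<^sub>C g j" using H_cases[OF vw(2)] by blast
    ultimately show ?thesis
      using orth[of i j] vw(3)
      by (cases "i = j") (auto simp: clinear_op_scaleC[OF clin] scaleC_ii_ii
          inner_scaleC_ii_left inner_scaleC_ii_self)
  qed
  have H_T: "(norm (T v))\<^sup>2 < b" if "v \<in> H" for v
    using H_cases[OF that] Tg c by (auto simp: norm_scaleC clinear_op_scaleC[OF clin])
  have gM: "g n \<in> M" for n
    unfolding M_def H_def by (intro subsetD[OF closure_subset] span_base) auto
  have "M \<noteq> {0}" using gM[of 0] unit[of 0] by auto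
  moreover have "csubspace M" "closed M"
    unfolding M_def H_def by (simp_all add: csubspace_closure_span)
  ultimately have "norm_attaining_on M T" using T by (simp add: AN_ops_def)
  then obtain x where x: "x \<in> M" "norm x = 1" "norm (T x) = onorm_on M T"
    by (auto simp: norm_attaining_on_def)
  have bdd: "bdd_above ((\<lambda>x. norm (T x) / norm x) ` M)"
  proof (rule bdd_aboveI2)
    show "norm (T x) / norm x \<le> norm T" for x
      by (cases "x = 0") (auto simp: pos_divide_le_eq norm_blinfun)
  qed
  have "c n \<le> (norm (T x))\<^sup>2" for n
  proof -
    have "norm (T (g n)) / norm (g n) \<le> norm (T x)"
      unfolding x(3) onorm_on_def by (rule cSUP_upper[OF gM bdd])
    then show ?thesis using unit Tg[of n] power_mono[of "norm (T (g n))" "norm (T x)" 2] by simp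
  qed
  then have Tx: "b \<le> (norm (T x))\<^sup>2"
    by (intro LIMSEQ_le_const2[OF c_lim]) auto
  have "inner x w = 0" if "w \<in> H" for w
  proof -
    \<comment> \<open>The coefficient on the left is strictly positive, since no generator reaches
      level \<open>b\<close>; a right-hand side \<open>\<le> 0\<close> therefore forces
      \<open>inner x w = 0\<close>.\<close>
    have "(b - (norm (T w))\<^sup>2) * (inner x w)\<^sup>2 \<le> b * (norm x)\<^sup>2 - (norm (T x))\<^sup>2"
      using x(1) that H_unit H_orth H_T unfolding M_def
      by (intro orthogonal_family_form_lower_bound[of H]) (auto intro: less_imp_le)
    also have "\<dots> \<le> 0" using Tx x(2) by simp
    finally show ?thesis
      using H_T[OF that] by (simp add: mult_le_0_iff)
  qed
  then have "span H \<subseteq> {y. inner x y = 0}"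
    by (intro span_minimal) (auto simp: subspace_def inner_add_right)
  moreover have "closed {y. inner x y = 0}"
    by (intro closed_Collect_eq continuous_intros)
  ultimately have "M \<subseteq> {y. inner x y = 0}"
    unfolding M_def by (rule closure_minimal)
  then have "inner x x = 0" using x(1) by blast
  then show False using x(2) by simp
qed

text \<open>A nearby \<open>S\<close> in \<open>AN_ops\<close> changes the squared norms at unit
  vectors by at most a third of the gap, so a third of it survives for \<open>S\<close>. The size
  \<open>d\<close> of the perturbation comes from factoring the difference of squares, whose second
  factor is at most \<open>2 * norm T + 1\<close>.\<close>

lemma closure_AN_ops_no_gap:
  fixes T :: "'a::complex_inner \<Rightarrow>\<^sub>L 'b::complex_inner"
  assumes T: "T \<in> closure AN_ops" and ab: "a < b"
    and lo: "\<And>F. finite F \<Longrightarrow> \<exists>x\<in>common_kernel F. norm x = 1 \<and> (norm (T x))\<^sup>2 \<le> a"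
    and hi: "\<And>F. finite F \<Longrightarrow> \<exists>x\<in>common_kernel F. norm x = 1 \<and> b \<le> (norm (T x))\<^sup>2"
  shows False
proof -
  define e where "e = (b - a) / 3"
  have e: "e > 0" using ab by (simp add: e_def)
  define d where "d = min 1 (e / (2 * norm T + 1))"
  have T1: "2 * norm T + 1 > 0" using norm_ge_zero[of T] by linarith
  then have d: "d > 0" "d \<le> 1" "d \<le> e / (2 * norm T + 1)"
    using e by (auto simp: d_def)
  obtain S where S: "S \<in> AN_ops" "dist S T < d"
    using T d(1) unfolding closure_approachable by blast
  have close: "\<bar>(norm (S x))\<^sup>2 - (norm (T x))\<^sup>2\<bar> \<le> e" if x: "norm x = 1" for x
  proof -
    have "\<bar>norm (S x) - norm (T x)\<bar> \<le> norm ((S - T) x)"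
      by (simp add: blinfun.diff_left norm_triangle_ineq3)
    also have "\<dots> \<le> d"
      using norm_blinfun[of "S - T" x] x S(2) by (simp add: dist_norm)
    finally have 1: "\<bar>norm (S x) - norm (T x)\<bar> \<le> d" .
    moreover have "norm (T x) \<le> norm T" using norm_blinfun[of T x] x by simp
    ultimately have 2: "norm (S x) + norm (T x) \<le> 2 * norm T + 1" using d(2) by linarith
    have "\<bar>(norm (S x))\<^sup>2 - (norm (T x))\<^sup>2\<bar>
        = \<bar>norm (S x) - norm (T x)\<bar> * (norm (S x) + norm (T x))"
      by (simp add: square_diff_square_factored power2_eq_square abs_mult)
    also have "\<dots> \<le> d * (2 * norm T + 1)"
      using 1 2 d by (intro mult_mono) auto
    also have "\<dots> \<le> e" using d(3) T1 by (simp add: pos_le_divide_eq)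
    finally show ?thesis .
  qed
  show False
  proof (rule AN_ops_no_gap[OF S(1)])
    show "a + e < b - e" using ab by (simp add: e_def field_simps)
    fix F :: "('a \<Rightarrow>\<^sub>L real) set" assume F: "finite F"
    show "\<exists>x\<in>common_kernel F. norm x = 1 \<and> (norm (S x))\<^sup>2 \<le> a + e"
      using lo[OF F] close by (smt (verit))
    show "\<exists>x\<in>common_kernel F. norm x = 1 \<and> b - e \<le> (norm (S x))\<^sup>2"
      using hi[OF F] close by (smt (verit))
  qed
qed

section \<open>The form of \<open>T\<close> is nearly constant in finite codimension\<close>

lemma unit_vector_with_same_square_ratio:
  fixes T :: "'a::real_normed_vector \<Rightarrow>\<^sub>L 'b::real_normed_vector"
  assumes "subspace N" "x \<in> N" "x \<noteq> 0"
  shows "\<exists>u\<in>N. norm u = 1 \<and> (norm (T u))\<^sup>2 * (norm x)\<^sup>2 = (norm (T x))\<^sup>2"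
  using assms
  by (intro bexI[of _ "x /\<^sub>R norm x"])
    (auto simp: subspace_scale blinfun.bilinear_simps power_mult_distrib power_inverse)

text \<open>\<open>\<beta>\<close> is the infimum of the upper bounds valid on some common kernel,
  so the upper estimate is immediate. If the lower one failed for \<open>e\<close>, values
  \<open>\<le> \<beta> - e\<close> and \<open>\<ge> \<beta> - e/2\<close> would occur on every
  common kernel, a forbidden gap.\<close>

lemma closure_AN_ops_form_nearly_constant:
  fixes T :: "'a::complex_inner \<Rightarrow>\<^sub>L 'b::complex_inner"
  assumes T: "T \<in> closure AN_ops"
  shows "\<exists>\<beta>\<ge>0. \<forall>e>0. \<exists>F. finite F \<and>
    (\<forall>x\<in>common_kernel F. \<bar>(norm (T x))\<^sup>2 - \<beta> * (norm x)\<^sup>2\<bar> \<le> e * (norm x)\<^sup>2)"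
proof -
  \<comment> \<open>The condition \<open>s \<ge> 0\<close> bounds \<open>U\<close> below even if
    some common kernel is trivial; in finite dimension it makes \<open>\<beta> = 0\<close>.\<close>
  define U where
    "U = {s. s \<ge> 0 \<and> (\<exists>F. finite F \<and> (\<forall>x\<in>common_kernel F. (norm (T x))\<^sup>2 \<le> s * (norm x)\<^sup>2))}"
  define \<beta> where "\<beta> = Inf U"
  have "(norm (T x))\<^sup>2 \<le> (norm T)\<^sup>2 * (norm x)\<^sup>2" for x
    using power_mono[OF norm_blinfun[of T x] norm_ge_zero, of 2] by (simp add: power_mult_distrib)
  then have "(norm T)\<^sup>2 \<in> U" unfolding U_def by auto
  then have ne: "U \<noteq> {}" by blast
  have bdd: "bdd_below U" by (auto simp: U_def intro: bdd_belowI)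
  have "\<beta> \<ge> 0" unfolding \<beta>_def using ne by (intro cInf_greatest) (auto simp: U_def)
  moreover have "\<exists>F. finite F \<and>
    (\<forall>x\<in>common_kernel F. \<bar>(norm (T x))\<^sup>2 - \<beta> * (norm x)\<^sup>2\<bar> \<le> e * (norm x)\<^sup>2)" if e: "e > 0" for e
  proof -
    obtain s where "s \<in> U" "s < \<beta> + e"
      using ne e cInf_lessD[of U "\<beta> + e"] by (auto simp: \<beta>_def)
    then obtain F1 where F1: "finite F1"
      "\<And>x. x \<in> common_kernel F1 \<Longrightarrow> (norm (T x))\<^sup>2 \<le> (\<beta> + e) * (norm x)\<^sup>2"
      unfolding U_def by (smt (verit) mem_Collect_eq mult_right_mono zero_le_power2)
    have "\<exists>F. finite F \<and> (\<forall>x\<in>common_kernel F. (\<beta> - e) * (norm x)\<^sup>2 \<le> (norm (T x))\<^sup>2)"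
    proof (rule ccontr)
      assume "\<not> ?thesis"
      then have *: "\<exists>x\<in>common_kernel F. (norm (T x))\<^sup>2 < (\<beta> - e) * (norm x)\<^sup>2" if "finite F" for F
        using that by (meson not_le)
      have lo: "\<exists>x\<in>common_kernel F. norm x = 1 \<and> (norm (T x))\<^sup>2 \<le> \<beta> - e" if F: "finite F" for F
      proof -
        obtain x where x: "x \<in> common_kernel F" "(norm (T x))\<^sup>2 < (\<beta> - e) * (norm x)\<^sup>2"
          using *[OF F] by blast
        then have "x \<noteq> 0" by auto
        then show ?thesis
          using unit_vector_with_same_square_ratio[OF subspace_common_kernel x(1), of T] x(2)
          by (smt (verit) mult_right_mono zero_le_power2)
      qed
      \<comment> \<open>Thus \<open>\<beta> - e/2\<close> is nonnegative, and it can fail to lie in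
        \<open>U\<close> only because its upper bound fails on every common kernel.\<close>
      have "\<beta> - e > 0"
        using *[of "{}"] by (smt (verit) finite.emptyI mult_nonpos_nonneg zero_le_power2)
      moreover have "\<beta> - e/2 \<notin> U"
        using cInf_lower[OF _ bdd, of "\<beta> - e/2"] e by (auto simp: \<beta>_def)
      ultimately have **: "\<exists>x\<in>common_kernel F. (\<beta> - e/2) * (norm x)\<^sup>2 < (norm (T x))\<^sup>2"
        if "finite F" for F
        using that e unfolding U_def by (smt (verit) field_sum_of_halves mem_Collect_eq)
      have hi: "\<exists>x\<in>common_kernel F. norm x = 1 \<and> \<beta> - e/2 \<le> (norm (T x))\<^sup>2" if F: "finite F" for F
      proof -
        obtain x where x: "x \<in> common_kernel F" "(\<beta> - e/2) * (norm x)\<^sup>2 < (norm (T x))\<^sup>2"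
          using **[OF F] by blast
        then have "x \<noteq> 0" by auto
        then show ?thesis
          using unit_vector_with_same_square_ratio[OF subspace_common_kernel x(1), of T] x(2)
          by (smt (verit) mult_right_mono zero_le_power2)
      qed
      show False
        using e by (intro closure_AN_ops_no_gap[OF T _ lo hi]) auto
    qed
    then obtain F2 where F2: "finite F2"
      "\<And>x. x \<in> common_kernel F2 \<Longrightarrow> (\<beta> - e) * (norm x)\<^sup>2 \<le> (norm (T x))\<^sup>2"
      by blast
    show ?thesis
    proof (intro exI conjI ballI)
      show "finite (F1 \<union> F2)" using F1 F2 by simp
      fix x assume "x \<in> common_kernel (F1 \<union> F2)"
      then show "\<bar>(norm (T x))\<^sup>2 - \<beta> * (norm x)\<^sup>2\<bar> \<le> e * (norm x)\<^sup>2"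
        using F1(2)[of x] F2(2)[of x]
        by (auto simp: common_kernel_Un abs_le_iff algebra_simps)
    qed
  qed
  ultimately show ?thesis by blast
qed

section \<open>From the quadratic form to the operator\<close>

text \<open>Polarization and the parallelogram law, applied to \<open>x\<close> and the multiple
  \<open>y\<close> of \<open>C x\<close> with the norm of \<open>x\<close>. In place of invariance
  of \<open>N\<close>, membership of \<open>C x\<close> for the given \<open>x\<close> is
  assumed.\<close>

lemma symmetric_form_bound:
  fixes C :: "'a::real_inner \<Rightarrow>\<^sub>L 'a"
  assumes N: "subspace N" and sym: "\<And>x y. inner (C x) y = inner x (C y)"
    and form: "\<And>x. x \<in> N \<Longrightarrow> \<bar>inner (C x) x\<bar> \<le> e * (norm x)\<^sup>2"
    and x: "x \<in> N" and Cx: "C x \<in> N" and e: "e \<ge> 0"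
  shows "norm (C x) \<le> e * norm x"
proof (cases "C x = 0 \<or> x = 0")
  case True
  then show ?thesis using e by auto
next
  case False
  define t where "t = norm x / norm (C x)"
  have t: "t > 0" using False by (simp add: t_def)
  define y where "y = t *\<^sub>R C x"
  have y: "y \<in> N" "norm y = norm x"
    using False Cx N by (auto simp: y_def t_def subspace_scale)
  have "4 * inner (C x) y = inner (C (x + y)) (x + y) - inner (C (x - y)) (x - y)"
    using sym[of y x]
    by (simp add: blinfun.bilinear_simps inner_add inner_diff inner_commute algebra_simps)
  also have "\<dots> \<le> e * (norm (x + y))\<^sup>2 + e * (norm (x - y))\<^sup>2"
    using form[of "x + y"] form[of "x - y"] x y(1) N
    by (simp add: subspace_add subspace_diff abs_le_iff)
  also have "\<dots> = 4 * e * (norm x)\<^sup>2"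
    using y(2) by (simp add: power2_norm_eq_inner inner_add inner_diff inner_commute
        norm_eq algebra_simps)
  finally have "t * (norm (C x))\<^sup>2 \<le> e * (norm x)\<^sup>2"
    by (simp add: y_def power2_norm_eq_inner)
  then show ?thesis
    using False by (simp add: t_def power2_eq_square)
qed

lemma clinear_op_compose: "clinear_op S \<Longrightarrow> clinear_op T \<Longrightarrow> clinear_op (S o\<^sub>L T)"
  by (simp add: clinear_op_def)

lemma clinear_op_minus_scaleR: "clinear_op S \<Longrightarrow> clinear_op T \<Longrightarrow> clinear_op (S - r *\<^sub>R T)"
  by (simp add: clinear_op_def blinfun.bilinear_simps
      linear_diff[OF bounded_linear.linear[OF bounded_linear_scaleC]]
      linear_scale[OF bounded_linear.linear[OF bounded_linear_scaleC]])

theorem theorem3p7: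
  fixes T W :: "'a::complex_hilbert_space \<Rightarrow>\<^sub>L 'b::complex_hilbert_space"
    and A :: "'a \<Rightarrow>\<^sub>L 'a"
  assumes "T \<in> closure AN_ops"
    and "polar_decomposition T W A"
  shows "\<exists>(\<alpha>::real) K. \<alpha> \<ge> 0 \<and> compact_op K \<and> T = \<alpha> *\<^sub>R W + K"
proof -
  from assms(2) obtain S where A: "clinear_op A" "\<And>x. cinner (A x) x \<in> \<real>\<^sub>\<ge>\<^sub>0"
    and S: "is_adjoint T S" "A o\<^sub>L A = S o\<^sub>L T" and W: "clinear_op W" "T = W o\<^sub>L A"
    by (auto simp: polar_decomposition_def is_modulus_def positive_op_def partial_isometry_def)
  have posA: "inner (A x) x \<ge> 0" for x
    using A(2)[of x] by (simp add: inner_eq_Re_cinner complex_nonneg_Reals_iff)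
  have AA: "A (A x) = S (T x)" for x
    using arg_cong[OF S(2), of "\<lambda>B. blinfun_apply B x"] by simp
  have adj: "inner (T x) y = inner x (S y)" for x y
    using S(1) by (simp add: is_adjoint_def inner_eq_Re_cinner)
  obtain \<beta> where \<beta>: "\<beta> \<ge> 0" "\<And>e. e > 0 \<Longrightarrow> \<exists>F. finite F \<and>
    (\<forall>x\<in>common_kernel F. \<bar>(norm (T x))\<^sup>2 - \<beta> * (norm x)\<^sup>2\<bar> \<le> e * (norm x)\<^sup>2)"
    using closure_AN_ops_form_nearly_constant[OF assms(1)] by blast
  define \<alpha> where "\<alpha> = sqrt \<beta>"
  have \<alpha>: "\<alpha> \<ge> 0" "\<beta> = \<alpha>\<^sup>2" using \<beta>(1) by (auto simp: \<alpha>_def)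
  define K where "K = T - \<alpha> *\<^sub>R W"
  have "\<exists>F. finite F \<and> (\<forall>x\<in>common_kernel F. norm (K x) \<le> e * norm x)" if e: "e > 0" for e
  proof (cases "\<alpha> = 0")
    \<comment> \<open>Division by \<open>\<alpha>\<close> is impossible here, but
      \<open>K = T\<close> and the form bounds \<open>T\<close> directly; it controls the squared
      norm, hence the tolerance \<open>e\<^sup>2\<close>.\<close>
    case True
    obtain F where F: "finite F"
      "\<And>x. x \<in> common_kernel F \<Longrightarrow> \<bar>(norm (T x))\<^sup>2 - \<beta> * (norm x)\<^sup>2\<bar> \<le> e\<^sup>2 * (norm x)\<^sup>2"
      using \<beta>(2)[of "e\<^sup>2"] e by auto
    have "norm (K x) \<le> e * norm x" if "x \<in> common_kernel F" for x
    proof (rule power2_le_imp_le)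
      show "(norm (K x))\<^sup>2 \<le> (e * norm x)\<^sup>2"
        using F(2)[OF that] True \<alpha> by (simp add: K_def power_mult_distrib)
    qed (use e in auto)
    with F(1) show ?thesis by blast
  next
    case False
    then have \<alpha>pos: "\<alpha> > 0" using \<alpha> by simp
    define C where "C = (S o\<^sub>L T) - \<beta> *\<^sub>R id_blinfun"
    have Cx: "C x = S (T x) - \<beta> *\<^sub>R x" for x
      by (simp add: C_def blinfun.bilinear_simps)
    have Cxy: "inner (C x) y = inner (T x) (T y) - \<beta> * inner x y" for x y
      using adj[of y "T x"] by (simp add: Cx inner_diff_left inner_commute[of "S (T x)" y]
          inner_commute[of "T y"])
    have sym: "inner (C x) y = inner x (C y)" for x y
      using Cxy[of x y] Cxy[of y x] by (simp add: inner_commute)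
    \<comment> \<open>Chosen so that \<open>(norm W + 1) * (d / \<alpha>) = e\<close>; the added
      \<open>1\<close> keeps the denominator positive when \<open>W = 0\<close>.\<close>
    define d where "d = e * \<alpha> / (norm W + 1)"
    have W1: "norm W + 1 > 0" using norm_ge_zero[of W] by linarith
    have d: "d > 0" using e \<alpha>pos W1 by (simp add: d_def)
    obtain F where F: "finite F"
      "\<And>x. x \<in> common_kernel F \<Longrightarrow> \<bar>(norm (T x))\<^sup>2 - \<beta> * (norm x)\<^sup>2\<bar> \<le> d * (norm x)\<^sup>2"
      using \<beta>(2)[OF d] by auto
    \<comment> \<open>The functionals \<open>f \<circ> C\<close> keep \<open>C x\<close> in the kernel of \<open>F\<close>, as the form bound requires.\<close>
    let ?F = "F \<union> (\<lambda>f. f o\<^sub>L C) ` F"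
    have "norm (K x) \<le> e * norm x" if x: "x \<in> common_kernel ?F" for x
    proof -
      have xF: "x \<in> common_kernel F" "C x \<in> common_kernel F"
        using x by (auto simp: common_kernel_def ball_Un)
      have nC: "norm (C x) \<le> d * norm x"
        using F(2) d xF
        by (intro symmetric_form_bound[OF subspace_common_kernel sym])
          (auto simp: Cxy power2_norm_eq_inner)
      define y where "y = A x - \<alpha> *\<^sub>R x"
      \<comment> \<open>Since \<open>A\<close> is positive, \<open>A + \<alpha>\<close> is bounded
        below by \<open>\<alpha>\<close>, so smallness of \<open>C x\<close> passes to
        \<open>y\<close>.\<close>
      have "C x = A y + \<alpha> *\<^sub>R y"
        by (simp add: Cx AA[symmetric] y_def blinfun.bilinear_simps \<alpha>(2) power2_eq_square
            algebra_simps)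
      then have "\<alpha> * (norm y)\<^sup>2 \<le> inner (C x) y"
        using posA[of y] by (simp add: inner_add_left power2_norm_eq_inner)
      also have "\<dots> \<le> norm (C x) * norm y" by (rule norm_cauchy_schwarz)
      finally have "\<alpha> * norm y \<le> norm (C x)"
        by (cases "y = 0") (auto simp: power2_eq_square)
      with nC have "norm y \<le> d * norm x / \<alpha>" using \<alpha>pos by (simp add: field_simps)
      have "K x = W y"
        by (simp add: K_def W(2) y_def blinfun.bilinear_simps)
      then have "norm (K x) \<le> norm W * norm y" by (simp add: norm_blinfun)
      also have "\<dots> \<le> (norm W + 1) * (d * norm x / \<alpha>)"
        using \<open>norm y \<le> d * norm x / \<alpha>\<close> by (intro mult_mono) auto
      also have "\<dots> = e * norm x" using W1 \<alpha>pos by (simp add: d_def)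
      finally show ?thesis .
    qed
    with F(1) show ?thesis by (intro exI[of _ ?F]) auto
  qed
  from compact_if_small_on_common_kernels[OF this]
  have "compact (closure (blinfun_apply K ` cball 0 1))" .
  moreover have "clinear_op K"
    unfolding K_def using W A(1) by (simp add: clinear_op_minus_scaleR clinear_op_compose)
  ultimately have "compact_op K" by (simp add: compact_op_def)
  then show ?thesis
    using \<alpha>(1) by (intro exI[of _ \<alpha>] exI[of _ K]) (simp add: K_def)
qed

end
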